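(* Let $\ell_1,\ell_2>0$. The distribution ${\mathcal D}$ on ${\mathcal C}$ is completely non-integrable with growth vector $(2,3,4)$; that is, at every point of ${\mathcal C}$ the spaces ${\mathcal D}$, ${\mathcal D}^2={\mathcal D}+[{\mathcal D},{\mathcal D}]$, ${\mathcal D}^3={\mathcal D}^2+[{\mathcal D},{\mathcal D}^2]$ have dimensions $2,3,4$, respectively.
   Context: 2-linkage: a triple of points $x,m_1,m_2\in\mathbb{R}^2$ with $|xm_1|=\ell_1$, $|xm_2|=\ell_2$ fixed. Coordinates: $x=(x_1,x_2)$ and the directions $\alpha_1,\alpha_2\in\mathbb{R}/2\pi\mathbb{Z}$ of the oriented segments $m_1x$, $m_2x$, so $m_i=x-\ell_i(\cos\alpha_i,\sin\alpha_i)$. The configuration space ${\mathcal C}$ is $\mathbb{R}^2\times T^2$ with the locus $m_1=m_2$ removed (i.e. ${\mathcal C}=\mathbb{R}^2\times T^2$ if $\ell_1\ne\ell_2$, and the set $\alpha_1=\alpha_2$ is removed if $\ell_1=\ell_2$). The 2-dimensional distribution ${\mathcal D}$ on ${\mathcal C}$ expresses the no-slip condition that, for $i=1,2$, the velocity of $m_i$ is parallel to the segment $m_ix$; equivalently ${\mathcal D}=\ker\lambda_1\cap\ker\lambda_2$ with $\lambda_i=\sin\alpha_i\,dx_1-\cos\alpha_i\,dx_2+\ell_i\,d\alpha_i$. *)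

theory Defs
  imports "HOL-Analysis.Analysis" "HOL-Library.Real_Mod"
begin

section \<open>The circle of angles\<close>

quotient_type angle = real / "\<lambda>a b. [a = b] (rmod 2 * pi)"
  by (intro equivpI reflpI sympI transpI) (auto intro: rcong_sym rcong_trans)

lemma rcong_2pi_iff: "[a = b] (rmod 2 * pi) \<longleftrightarrow> sin a = sin b \<and> cos a = cos b"
  by (subst rcong_sym_iff) (simp add: rcong_altdef sin_cos_eq_iff mult.commute)

lift_definition angle_sin :: "angle \<Rightarrow> real" is sin
  by (simp add: rcong_2pi_iff)

lift_definition angle_cos :: "angle \<Rightarrow> real" is cos
  by (simp add: rcong_2pi_iff)

instantiation angle :: topological_space
begin

definition open_angle :: "angle set \<Rightarrow> bool"
  where "open_angle U \<longleftrightarrow> open (abs_angle -` U)"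

instance
  by standard (auto simp: open_angle_def vimage_Union)

end

section \<open>Smooth vector fields on the product of the plane with a torus\<close>

type_synonym config = "(real^2) \<times> angle \<times> angle"

text \<open>
  The tangent bundle of \<^typ>\<open>config\<close> is trivialised by the coordinate fields
  $\partial_{x_1}, \partial_{x_2}, \partial_{\alpha_1}, \partial_{\alpha_2}$, so that a vector
  field is a function \<^typ>\<open>config \<Rightarrow> (real^2) \<times> real \<times> real\<close>. Differential notions are computed
  on the universal cover, via the covering map \<open>roll\<close>, whose local inverses are the charts.
\<close>

type_synonym tangent = "(real^2) \<times> real \<times> real"

definition roll :: "(real^2) \<times> real \<times> real \<Rightarrow> config"
  where "roll = (\<lambda>(x, a1, a2). (x, abs_angle a1, abs_angle a2))"

definition unroll :: "config \<Rightarrow> (real^2) \<times> real \<times> real"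
  where "unroll p = (SOME u. roll u = p)"

lemma roll_unroll [simp]: "roll (unroll p) = p"
proof -
  obtain x a1 a2 where p: "p = (x, a1, a2)" by (cases p)
  have "roll (x, rep_angle a1, rep_angle a2) = p"
    by (simp add: p roll_def Quotient3_abs_rep[OF Quotient3_angle])
  then show ?thesis unfolding unroll_def by (rule someI)
qed

text \<open>\<open>Ck k S f\<close>: on the open set \<open>S\<close>, \<open>f\<close> is of class $C^k$.\<close>

primrec Ck :: "nat \<Rightarrow> 'a set \<Rightarrow> ('a::real_normed_vector \<Rightarrow> 'b::real_normed_vector) \<Rightarrow> bool"
  where
    "Ck 0 S f \<longleftrightarrow> continuous_on S f"
  | "Ck (Suc k) S f \<longleftrightarrow> (\<forall>x\<in>S. f differentiable (at x)) \<and>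
       (\<forall>v. Ck k S (\<lambda>x. frechet_derivative f (at x) v))"

definition smooth_on :: "'a set \<Rightarrow> ('a::real_normed_vector \<Rightarrow> 'b::real_normed_vector) \<Rightarrow> bool"
  where "smooth_on S f \<longleftrightarrow> (\<forall>k. Ck k S f)"

definition smooth_field_on :: "config set \<Rightarrow> (config \<Rightarrow> tangent) \<Rightarrow> bool"
  where "smooth_field_on U V \<longleftrightarrow> smooth_on (roll -` U) (V \<circ> roll)"

definition lie_bracket :: "(config \<Rightarrow> tangent) \<Rightarrow> (config \<Rightarrow> tangent) \<Rightarrow> config \<Rightarrow> tangent"
  where "lie_bracket V W p =
    frechet_derivative (W \<circ> roll) (at (unroll p)) (V p) -
    frechet_derivative (V \<circ> roll) (at (unroll p)) (W p)"

text \<open>The bracket does not depend on the choice of the lift of a point to the universal cover.\<close>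

lemma roll_eq_imp_translate:
  assumes "roll u = roll u'"
  shows "roll (v + (u' - u)) = roll v"
proof -
  obtain x a b where u: "u = (x, a, b)" by (cases u)
  obtain x' a' b' where u': "u' = (x', a', b')" by (cases u')
  obtain y c d where v: "v = (y, c, d)" by (cases v)
  have eq: "x = x'" "[a = a'] (rmod 2 * pi)" "[b = b'] (rmod 2 * pi)"
    using assms by (auto simp: roll_def u u' angle.abs_eq_iff)
  have "[c + (a' - a) = c] (rmod 2 * pi)" "[d + (b' - b) = d] (rmod 2 * pi)"
    using rcong_add[OF rcong_refl rcong_diff[OF rcong_sym[OF eq(2)] rcong_refl], of c a]
      rcong_add[OF rcong_refl rcong_diff[OF rcong_sym[OF eq(3)] rcong_refl], of d b]
    by simp_all
  then show ?thesis
    by (simp add: roll_def u u' v eq(1) angle.abs_eq_iff)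
qed

lemma has_derivative_at_translate:
  fixes f :: "'a::real_normed_vector \<Rightarrow> 'b::real_normed_vector"
  assumes per: "\<And>v. f (v + t) = f v" and f: "(f has_derivative F) (at u)"
  shows "(f has_derivative F) (at (u + t))"
proof -
  have s: "((\<lambda>v. v - t) has_derivative (\<lambda>h. h)) (at (u + t))"
    by (auto intro!: derivative_eq_intros)
  have "(f \<circ> (\<lambda>v. v - t) has_derivative F \<circ> (\<lambda>h. h)) (at (u + t))"
    by (rule diff_chain_at[OF s]) (simp add: f)
  moreover have "f \<circ> (\<lambda>v. v - t) = f"
    using per[of "v - t" for v] by (auto simp: fun_eq_iff)
  ultimately show ?thesis by (simp add: comp_def)
qed

lemma frechet_derivative_roll_eq:
  assumes "roll u = roll u'"
  shows "frechet_derivative (V \<circ> roll) (at u) = frechet_derivative (V \<circ> roll) (at u')"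
proof -
  have "(V \<circ> roll has_derivative F) (at u) \<longleftrightarrow> (V \<circ> roll has_derivative F) (at u')" for F
    using has_derivative_at_translate[of "V \<circ> roll" "u' - u" F u]
      has_derivative_at_translate[of "V \<circ> roll" "u - u'" F u']
      roll_eq_imp_translate[OF assms] roll_eq_imp_translate[OF assms[symmetric]]
    by auto
  then show ?thesis unfolding frechet_derivative_def by simp
qed

lemma lie_bracket_roll:
  "lie_bracket V W (roll u) =
    frechet_derivative (W \<circ> roll) (at u) (V (roll u)) -
    frechet_derivative (V \<circ> roll) (at u) (W (roll u))"
proof -
  have "frechet_derivative (X \<circ> roll) (at (unroll (roll u))) = frechet_derivative (X \<circ> roll) (at u)"
    for X :: "config \<Rightarrow> tangent"
    by (rule frechet_derivative_roll_eq) simp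
  then show ?thesis unfolding lie_bracket_def by simp
qed

section \<open>Distributions and their Lie flag\<close>

text \<open>A distribution is a family of subspaces \<open>D p\<close> of the tangent spaces.\<close>

definition sections :: "(config \<Rightarrow> tangent set) \<Rightarrow> config set \<Rightarrow> (config \<Rightarrow> tangent) set"
  where "sections D U = {V. smooth_field_on U V \<and> (\<forall>p\<in>U. V p \<in> D p)}"

text \<open>
  \<open>flag_sections D U k\<close> is the space of vector fields over \<open>U\<close> making up $\mathcal D^k$, where
  $\mathcal D^{k+1} = \mathcal D^k + [\mathcal D, \mathcal D^k]$; here $[\mathcal D, \mathcal D^k]$
  consists of all finite sums of brackets.
\<close>

fun flag_sections :: "(config \<Rightarrow> tangent set) \<Rightarrow> config set \<Rightarrow> nat \<Rightarrow> (config \<Rightarrow> tangent) set"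
  where
    "flag_sections D U 0 = {\<lambda>p. 0}"
  | "flag_sections D U (Suc 0) = sections D U"
  | "flag_sections D U (Suc (Suc k)) =
      {\<lambda>p. Y p + (\<Sum>i<n. lie_bracket (X i) (Z i) p) | Y n X Z.
        Y \<in> flag_sections D U (Suc k) \<and>
        (\<forall>i<n::nat. X i \<in> sections D U \<and> Z i \<in> flag_sections D U (Suc k))}"

text \<open>The space $\mathcal D^k_p$, for a distribution on the open set \<open>M\<close>.\<close>

definition lie_flag :: "config set \<Rightarrow> (config \<Rightarrow> tangent set) \<Rightarrow> nat \<Rightarrow> config \<Rightarrow> tangent set"
  where "lie_flag M D k p =
    {V p | V U. open U \<and> p \<in> U \<and> U \<subseteq> M \<and> V \<in> flag_sections D U k}"

definition completely_nonintegrable_on :: "config set \<Rightarrow> (config \<Rightarrow> tangent set) \<Rightarrow> bool"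
  where "completely_nonintegrable_on M D \<longleftrightarrow> (\<forall>p\<in>M. \<exists>k. lie_flag M D k p = UNIV)"

section \<open>The 2-linkage\<close>

definition wheel :: "real \<Rightarrow> real^2 \<Rightarrow> angle \<Rightarrow> real^2"
  where "wheel l x \<alpha> = x - l *\<^sub>R vector [angle_cos \<alpha>, angle_sin \<alpha>]"

definition linkage_space :: "real \<Rightarrow> real \<Rightarrow> config set"
  where "linkage_space l1 l2 = {(x, \<alpha>1, \<alpha>2). wheel l1 x \<alpha>1 \<noteq> wheel l2 x \<alpha>2}"

definition no_slip_form :: "real \<Rightarrow> angle \<Rightarrow> real^2 \<Rightarrow> real \<Rightarrow> real"
  where "no_slip_form l \<alpha> dx d\<alpha> = angle_sin \<alpha> * dx $ 1 - angle_cos \<alpha> * dx $ 2 + l * d\<alpha>"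

definition linkage_distribution :: "real \<Rightarrow> real \<Rightarrow> config \<Rightarrow> tangent set"
  where "linkage_distribution l1 l2 = (\<lambda>(x, \<alpha>1, \<alpha>2).
    {(dx, d\<alpha>1, d\<alpha>2). no_slip_form l1 \<alpha>1 dx d\<alpha>1 = 0 \<and> no_slip_form l2 \<alpha>2 dx d\<alpha>2 = 0})"

text \<open>
  The forms express that the velocity of each wheel is parallel to its segment.
\<close>

lemma wheel_has_derivative:
  "((\<lambda>(x, a). wheel l x (abs_angle a)) has_derivative
    (\<lambda>(dx, da). dx - (l * da) *\<^sub>R vector [- sin a, cos a])) (at (x, a))"
proof -
  have "((\<lambda>q. fst q - l *\<^sub>R (cos (snd q) *\<^sub>R axis 1 1 + sin (snd q) *\<^sub>R axis 2 1) :: real^2)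
      has_derivative
      (\<lambda>q. fst q - l *\<^sub>R ((- sin a * snd q) *\<^sub>R axis 1 1 + (cos a * snd q) *\<^sub>R axis 2 1)))
      (at (x, a))"
    by (auto intro!: derivative_eq_intros simp: algebra_simps)
  moreover have "vector [c, s] = (c *\<^sub>R axis 1 1 + s *\<^sub>R axis 2 1 :: real^2)" for c s :: real
    by (simp add: vec_eq_iff forall_2 axis_def)
  ultimately show ?thesis
    by (simp add: case_prod_unfold wheel_def angle_cos.abs_eq angle_sin.abs_eq algebra_simps)
qed

lemma no_slip_iff:
  assumes "l > 0"
  shows "no_slip_form l (abs_angle a) dx da = 0 \<longleftrightarrow>
    (\<exists>c. frechet_derivative (\<lambda>(x, a). wheel l x (abs_angle a)) (at (x, a)) (dx, da) =
      c *\<^sub>R (x - wheel l x (abs_angle a)))"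
proof -
  have D: "frechet_derivative (\<lambda>(x, a). wheel l x (abs_angle a)) (at (x, a)) (dx, da) =
      dx - (l * da) *\<^sub>R vector [- sin a, cos a]"
    using frechet_derivative_at[OF wheel_has_derivative[of l a x], symmetric] by simp
  define p where "p = dx $ 1 + l * da * sin a"
  define q where "q = dx $ 2 - l * da * cos a"
  have n: "sin a * p - cos a * q = no_slip_form l (abs_angle a) dx da"
  proof -
    have "sin a * p - cos a * q = sin a * dx $ 1 - cos a * dx $ 2 + l * da * ((sin a)\<^sup>2 + (cos a)\<^sup>2)"
      unfolding p_def q_def power2_eq_square by algebra
    then show ?thesis
      by (simp add: no_slip_form_def angle_cos.abs_eq angle_sin.abs_eq)
  qed
  have "sin a * p - cos a * q = 0 \<longleftrightarrow> (\<exists>c. p = c * (l * cos a) \<and> q = c * (l * sin a))"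
  proof
    assume 0: "sin a * p - cos a * q = 0"
    have 1: "p = (p * cos a + q * sin a) * cos a + sin a * (sin a * p - cos a * q)"
      "q = (p * cos a + q * sin a) * sin a - cos a * (sin a * p - cos a * q)"
      using sin_cos_squared_add[of a] by algebra+
    show "\<exists>c. p = c * (l * cos a) \<and> q = c * (l * sin a)"
      by (rule exI[of _ "(p * cos a + q * sin a) / l"]) (use assms 0 1 in simp)
  qed (auto simp: algebra_simps)
  then show ?thesis
    unfolding n D
    by (simp add: vec_eq_iff forall_2 wheel_def angle_cos.abs_eq angle_sin.abs_eq p_def q_def mult.assoc)
qed


lemma continuous_on_angle:
  fixes f :: "angle \<Rightarrow> 'a::topological_space"
  assumes "continuous_on UNIV (\<lambda>a. f (abs_angle a))"
  shows "continuous_on UNIV f"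
  unfolding continuous_on_open_vimage[OF open_UNIV]
proof (intro allI impI)
  fix B :: "'a set" assume "open B"
  then have "open ((\<lambda>a. f (abs_angle a)) -` B)"
    using assms by (simp add: continuous_on_open_vimage)
  then show "open (f -` B \<inter> UNIV)"
    by (simp add: open_angle_def vimage_def)
qed

lemma open_linkage_space: "open (linkage_space l1 l2)"
proof -
  have [continuous_intros]: "continuous_on UNIV angle_sin" "continuous_on UNIV angle_cos"
    by (auto intro!: continuous_on_angle continuous_intros
        simp: angle_cos.abs_eq angle_sin.abs_eq)
  have v: "vector [c, s] = (c *\<^sub>R axis 1 1 + s *\<^sub>R axis 2 1 :: real^2)" for c s :: real
    by (simp add: vec_eq_iff forall_2 axis_def)
  have "continuous_on UNIV (\<lambda>p::config. wheel l (fst p) (h (snd p)))"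
    if "continuous_on UNIV h" for h :: "angle \<times> angle \<Rightarrow> angle" and l
  proof -
    have h: "continuous_on UNIV (\<lambda>p::config. h (snd p))"
      using that by (rule continuous_on_compose2) (auto intro: continuous_intros)
    have "continuous_on UNIV (\<lambda>p::config. angle_sin (h (snd p)))"
      "continuous_on UNIV (\<lambda>p::config. angle_cos (h (snd p)))"
      using \<open>continuous_on UNIV angle_sin\<close> \<open>continuous_on UNIV angle_cos\<close>
      by (auto intro: continuous_on_compose2[OF _ h])
    then show ?thesis unfolding wheel_def v by (intro continuous_intros)
  qed
  from this[of fst l1, OF continuous_on_fst[OF continuous_on_id]]
    this[of snd l2, OF continuous_on_snd[OF continuous_on_id]] show ?thesis
    by (auto simp: linkage_space_def case_prod_unfold intro!: open_Collect_neq continuous_intros)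
qed

lemma linkage_space_eq:
  assumes "l1 > 0" "l2 > 0"
  shows "linkage_space l1 l2 = (if l1 = l2 then {(x, \<alpha>1, \<alpha>2). \<alpha>1 \<noteq> \<alpha>2} else UNIV)"
proof -
  have "wheel l1 x \<alpha>1 = wheel l2 x \<alpha>2 \<longleftrightarrow> l1 = l2 \<and> \<alpha>1 = \<alpha>2" for x \<alpha>1 \<alpha>2
  proof
    assume "wheel l1 x \<alpha>1 = wheel l2 x \<alpha>2"
    then have 1: "l1 * angle_cos \<alpha>1 = l2 * angle_cos \<alpha>2" "l1 * angle_sin \<alpha>1 = l2 * angle_sin \<alpha>2"
      by (auto simp: wheel_def vec_eq_iff forall_2)
    have sc: "(angle_cos \<alpha>)\<^sup>2 + (angle_sin \<alpha>)\<^sup>2 = 1" for \<alpha>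
      by transfer simp
    have "(l1 * angle_cos \<alpha>1)\<^sup>2 + (l1 * angle_sin \<alpha>1)\<^sup>2 = (l2 * angle_cos \<alpha>2)\<^sup>2 + (l2 * angle_sin \<alpha>2)\<^sup>2"
      using 1 by simp
    then have "l1\<^sup>2 = l2\<^sup>2"
      using sc[of \<alpha>1] sc[of \<alpha>2] by algebra
    then have l: "l1 = l2" using assms by simp
    with 1 assms have "angle_cos \<alpha>1 = angle_cos \<alpha>2" "angle_sin \<alpha>1 = angle_sin \<alpha>2" by auto
    then have "\<alpha>1 = \<alpha>2" by transfer (simp add: rcong_2pi_iff)
    with l show "l1 = l2 \<and> \<alpha>1 = \<alpha>2" ..
  qed auto
  then show ?thesis by (auto simp: linkage_space_def)
qed

lemma smooth_trigonometric:
  "smooth_on S (\<lambda>u::(real^2) \<times> real \<times> real. c + cos (fst (snd u)) *\<^sub>R a + sin (fst (snd u)) *\<^sub>R b +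
     cos (snd (snd u)) *\<^sub>R d + sin (snd (snd u)) *\<^sub>R (e :: tangent))"
proof -
  define f where "f = (\<lambda>(c::tangent) a b d e (u::(real^2) \<times> real \<times> real). c + cos (fst (snd u)) *\<^sub>R a +
    sin (fst (snd u)) *\<^sub>R b + cos (snd (snd u)) *\<^sub>R d + sin (snd (snd u)) *\<^sub>R e)"
  have D: "(f c a b d e has_derivative (\<lambda>v. f 0 (fst (snd v) *\<^sub>R b) (- fst (snd v) *\<^sub>R a)
      (snd (snd v) *\<^sub>R e) (- snd (snd v) *\<^sub>R d) u)) (at u)" for c a b d e u
    unfolding f_def by (auto intro!: derivative_eq_intros simp: fun_eq_iff algebra_simps)
  have "Ck k S (f c a b d e)" for k c a b d e
  proof (induction k arbitrary: c a b d e)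
    case 0
    show ?case by (auto simp: f_def intro!: continuous_intros)
  next
    case (Suc k)
    have "(\<lambda>u. frechet_derivative (f c a b d e) (at u) v) =
        f 0 (fst (snd v) *\<^sub>R b) (- fst (snd v) *\<^sub>R a) (snd (snd v) *\<^sub>R e) (- snd (snd v) *\<^sub>R d)" for v
      by (rule ext) (simp only: frechet_derivative_at[OF D, symmetric])
    then show ?case
      unfolding Ck.simps differentiable_def using D Suc.IH by (metis (no_types, lifting))
  qed
  then show ?thesis by (simp add: smooth_on_def f_def)
qed

text \<open>For the linkage, $\mathcal D^1$ is the distribution itself.\<close>

lemma lie_flag_1_linkage:
  assumes "l1 > 0" "l2 > 0" "p \<in> linkage_space l1 l2"
  shows "lie_flag (linkage_space l1 l2) (linkage_distribution l1 l2) 1 p = linkage_distribution l1 l2 p"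
proof (intro subset_antisym subsetI)
  fix w assume w: "w \<in> linkage_distribution l1 l2 p"
  obtain x \<alpha>1 \<alpha>2 where p: "p = (x, \<alpha>1, \<alpha>2)" by (cases p)
  obtain v a1 a2 where wv: "w = (v, a1, a2)" by (cases w)
  define V where "V = (\<lambda>(x :: real^2, \<beta>1, \<beta>2). (v, (angle_cos \<beta>1 * v $ 2 - angle_sin \<beta>1 * v $ 1) / l1,
    (angle_cos \<beta>2 * v $ 2 - angle_sin \<beta>2 * v $ 1) / l2))"
  have "V \<circ> roll = (\<lambda>u. (v, 0, 0) + cos (fst (snd u)) *\<^sub>R (0, v $ 2 / l1, 0) +
      sin (fst (snd u)) *\<^sub>R (0, - v $ 1 / l1, 0) +
      cos (snd (snd u)) *\<^sub>R (0, 0, v $ 2 / l2) + sin (snd (snd u)) *\<^sub>R (0, 0, - v $ 1 / l2))"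
    using assms by (auto simp: V_def roll_def fun_eq_iff angle_cos.abs_eq angle_sin.abs_eq field_simps)
  then have "smooth_field_on (linkage_space l1 l2) V"
    unfolding smooth_field_on_def by (simp only: smooth_trigonometric)
  then have "V \<in> sections (linkage_distribution l1 l2) (linkage_space l1 l2)"
    using assms by (auto simp: sections_def V_def linkage_distribution_def no_slip_form_def)
  moreover have "V p = w"
    using w assms by (auto simp: V_def p wv linkage_distribution_def no_slip_form_def field_simps)
  ultimately show "w \<in> lie_flag (linkage_space l1 l2) (linkage_distribution l1 l2) 1 p"
    using open_linkage_space assms(3) by (auto simp: lie_flag_def)
qed (auto simp: lie_flag_def sections_def)

end

theory Submission
  imports Defs
begin

text \<open>
  Write $\lambda_i$ for the two no-slip forms and $\dot x$ for the planar component of a tangent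
  vector. Since $l_i > 0$, a vector of the distribution is determined by $\dot x$, which is
  arbitrary; so $\mathcal D$ is spanned by the horizontal lifts of the constant plane fields and
  has rank 2.

  For sections $V, W$ of $\mathcal D$, differentiating the constraints $\lambda_i(V) = 0$ and
  $\lambda_i(W) = 0$ gives $l_i\,\lambda_i([V, W]) = \dot x(V) \times \dot x(W)$, the planar cross
  product, whose value is the same for $i = 1$ and $i = 2$. Hence $\mathcal D^2$ lies in the kernel
  of the single form $l_1 \lambda_1 - l_2 \lambda_2$, which has rank 3
  (\<open>lie_flag_2_subset\<close>). Equality holds because the lifts of $\partial_{x_1}$ and
  $\partial_{x_2}$ have as bracket the constant rotation field
  $Z = l_1^{-2}\partial_{\alpha_1} + l_2^{-2}\partial_{\alpha_2}$, which is outside $\mathcal D$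
  (\<open>lie_flag_2_linkage\<close>).

  The form $l_1 \lambda_1 - l_2 \lambda_2$ takes on the bracket of $Z$ with the lift of a constant
  field $q$ the value $\langle q, e_1 / l_1 - e_2 / l_2\rangle$, where
  $e_i = (\cos \alpha_i, \sin \alpha_i)$. The vector $e_1 / l_1 - e_2 / l_2$ vanishes only if
  $l_1 = l_2$ and $e_1 = e_2$, that is, only if the two wheels coincide, which the configuration space
  excludes. So a suitable $q$ supplies the missing direction and $\mathcal D^3$ is the whole
  tangent space (\<open>lie_flag_3_linkage\<close>).
\<close>

section \<open>The universal cover\<close>

lemma continuous_on_roll: "continuous_on UNIV roll"
proof -
  have "continuous_on UNIV abs_angle"
    by (simp add: continuous_on_open_vimage open_angle_def)
  then have "continuous_on UNIV (\<lambda>u::(real^2) \<times> real \<times> real. abs_angle (g u))"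
    if "continuous_on UNIV g" for g
    by (rule continuous_on_compose2[OF _ that]) simp
  then show ?thesis
    unfolding roll_def case_prod_unfold
    by (simp add: continuous_on_Pair continuous_on_fst continuous_on_snd continuous_on_id)
qed

lemma open_vimage_roll: "open U \<Longrightarrow> open (roll -` U)"
  using continuous_on_roll by (simp add: continuous_on_open_vimage)

lemma smooth_field_on_imp_differentiable:
  assumes "smooth_field_on U V" "roll u \<in> U"
  shows "(V \<circ> roll) differentiable (at u)"
proof -
  have "Ck (Suc 0) (roll -` U) (V \<circ> roll)"
    using assms(1) unfolding smooth_field_on_def smooth_on_def by blast
  then show ?thesis using assms(2) by simp
qed

lemma no_slip_form_abs_angle:
  "no_slip_form l (abs_angle a) dx da = sin a * dx $ 1 - cos a * dx $ 2 + l * da"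
  by (simp add: no_slip_form_def angle_sin.abs_eq angle_cos.abs_eq)

lemma angle_sin_cos_squared: "(angle_sin a)\<^sup>2 + (angle_cos a)\<^sup>2 = 1"
  by transfer simp

section \<open>Brackets of fields tangent to the distribution\<close>

definition cross2 :: "real^2 \<Rightarrow> real^2 \<Rightarrow> real"
  where "cross2 v w = v $ 1 * w $ 2 - v $ 2 * w $ 1"

text \<open>
  A field annihilated by a no-slip form on an open set has a differential controlled modulo the
  kernel of the form: the product rule shifts the derivative onto the coefficients $\sin$ and
  $\cos$. The projection $\pi$ selects one of the two angles, which allows both wheels to be treated
  at once.
\<close>

lemma derivative_of_constraint:
  fixes f :: "(real^2) \<times> real \<times> real \<Rightarrow> tangent"
  assumes "open S" "u \<in> S" "(f has_derivative D) (at u)" "bounded_linear \<pi>"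
    and constraint: "\<And>w. w \<in> S \<Longrightarrow>
      no_slip_form l (abs_angle (\<pi> (snd w))) (fst (f w)) (\<pi> (snd (f w))) = 0"
  shows "no_slip_form l (abs_angle (\<pi> (snd u))) (fst (D h)) (\<pi> (snd (D h))) =
    - \<pi> (snd h) * (cos (\<pi> (snd u)) * fst (f u) $ 1 + sin (\<pi> (snd u)) * fst (f u) $ 2)"
proof -
  let ?g = "\<lambda>w. sin (\<pi> (snd w)) * fst (f w) $ 1 - cos (\<pi> (snd w)) * fst (f w) $ 2
    + l * \<pi> (snd (f w))"
  let ?G = "\<lambda>h. sin (\<pi> (snd u)) * fst (D h) $ 1 + cos (\<pi> (snd u)) * \<pi> (snd h) * fst (f u) $ 1
    - (cos (\<pi> (snd u)) * fst (D h) $ 2 - sin (\<pi> (snd u)) * \<pi> (snd h) * fst (f u) $ 2)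
    + l * \<pi> (snd (D h))"
  note [derivative_intros] = assms(3) bounded_linear.has_derivative[OF assms(4)]
    bounded_linear.has_derivative[OF bounded_linear_vec_nth]
  have "(?g has_derivative ?G) (at u)"
    by (auto intro!: derivative_eq_intros simp: fun_eq_iff algebra_simps)
  moreover have "(?g has_derivative (\<lambda>h. 0)) (at u)"
    by (rule has_derivative_transform_within_open[OF has_derivative_const[of 0] assms(1,2)])
      (use constraint in \<open>simp add: no_slip_form_abs_angle\<close>)
  ultimately have "?G = (\<lambda>h. 0)"
    by (rule has_derivative_unique)
  then have "?G h = 0" by meson
  then show ?thesis by (simp add: no_slip_form_abs_angle algebra_simps)
qed

text \<open>
  This is Cartan's formula $\lambda([V, W]) = - d\lambda(V, W)$ for fields in $\ker\lambda$, made
  explicit: $d\lambda$ pairs the rotation rate of one field with the velocity of the other along the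
  segment, and the constraint expresses the rotation rates by the planar velocities. The factor
  $l$ on the left is what makes the right-hand side the same for both wheels.
\<close>

lemma no_slip_form_bracket:
  fixes V W :: "config \<Rightarrow> tangent"
  assumes "open U" "roll u \<in> U" "smooth_field_on U V" "smooth_field_on U W" "bounded_linear \<pi>"
    and V: "\<And>w. roll w \<in> U \<Longrightarrow>
      no_slip_form l (abs_angle (\<pi> (snd w))) (fst (V (roll w))) (\<pi> (snd (V (roll w)))) = 0"
    and W: "\<And>w. roll w \<in> U \<Longrightarrow>
      no_slip_form l (abs_angle (\<pi> (snd w))) (fst (W (roll w))) (\<pi> (snd (W (roll w)))) = 0"
  shows "l * no_slip_form l (abs_angle (\<pi> (snd u))) (fst (lie_bracket V W (roll u)))
      (\<pi> (snd (lie_bracket V W (roll u)))) = cross2 (fst (V (roll u))) (fst (W (roll u)))"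
proof -
  interpret \<pi>: bounded_linear \<pi> by fact
  let ?DV = "frechet_derivative (V \<circ> roll) (at u)" and ?DW = "frechet_derivative (W \<circ> roll) (at u)"
  let ?v = "V (roll u)" and ?w = "W (roll u)"
  let ?form = "\<lambda>t::tangent. no_slip_form l (abs_angle (\<pi> (snd u))) (fst t) (\<pi> (snd t))"
  define s c where "s = sin (\<pi> (snd u))" and "c = cos (\<pi> (snd u))"
  have S: "open (roll -` U)" "u \<in> roll -` U"
    using assms(1,2) open_vimage_roll by auto
  have DV: "(V \<circ> roll has_derivative ?DV) (at u)" and DW: "(W \<circ> roll has_derivative ?DW) (at u)"
    using smooth_field_on_imp_differentiable assms(2-4) frechet_derivative_works by blast+
  have 1: "?form (?DV ?w) = - \<pi> (snd ?w) * (c * fst ?v $ 1 + s * fst ?v $ 2)"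
    using derivative_of_constraint[OF S DV assms(5), of l ?w] V by (simp add: s_def c_def)
  have 2: "?form (?DW ?v) = - \<pi> (snd ?v) * (c * fst ?w $ 1 + s * fst ?w $ 2)"
    using derivative_of_constraint[OF S DW assms(5), of l ?v] W by (simp add: s_def c_def)
  have 3: "l * \<pi> (snd ?v) = c * fst ?v $ 2 - s * fst ?v $ 1"
    "l * \<pi> (snd ?w) = c * fst ?w $ 2 - s * fst ?w $ 1"
    using V[OF assms(2)] W[OF assms(2)] by (simp_all add: no_slip_form_abs_angle s_def c_def)
  have "?form (lie_bracket V W (roll u)) = ?form (?DW ?v) - ?form (?DV ?w)"
    by (simp add: lie_bracket_roll no_slip_form_abs_angle \<pi>.diff algebra_simps)
  then have "l * ?form (lie_bracket V W (roll u)) =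
      (l * \<pi> (snd ?w)) * (c * fst ?v $ 1 + s * fst ?v $ 2) -
      (l * \<pi> (snd ?v)) * (c * fst ?w $ 1 + s * fst ?w $ 2)"
    unfolding 1 2 by algebra
  also have "\<dots> = (s\<^sup>2 + c\<^sup>2) * cross2 (fst ?v) (fst ?w)"
    unfolding 3 cross2_def by algebra
  finally show ?thesis by (simp add: s_def c_def)
qed

section \<open>The derived distribution\<close>

text \<open>The form $l_1 \lambda_1 - l_2 \lambda_2$, whose kernel is going to be $\mathcal D^2$.\<close>

definition slip_defect :: "real \<Rightarrow> real \<Rightarrow> config \<Rightarrow> tangent \<Rightarrow> real"
  where "slip_defect l1 l2 = (\<lambda>(x, \<alpha>1, \<alpha>2) (dx, d\<alpha>1, d\<alpha>2).
    l1 * no_slip_form l1 \<alpha>1 dx d\<alpha>1 - l2 * no_slip_form l2 \<alpha>2 dx d\<alpha>2)"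

lemma linear_slip_defect: "linear (slip_defect l1 l2 p)"
  by (cases p, rule linearI) (auto simp: slip_defect_def no_slip_form_def algebra_simps)

lemma slip_defect_distribution:
  "v \<in> linkage_distribution l1 l2 p \<Longrightarrow> slip_defect l1 l2 p v = 0"
  by (auto simp: slip_defect_def linkage_distribution_def)

lemma slip_defect_bracket:
  assumes "open U" "p \<in> U"
    and V: "V \<in> sections (linkage_distribution l1 l2) U"
    and W: "W \<in> sections (linkage_distribution l1 l2) U"
  shows "slip_defect l1 l2 p (lie_bracket V W p) = 0"
proof -
  define u where "u = unroll p"
  have p: "p = roll u" by (simp add: u_def)
  have slip: "no_slip_form l1 (abs_angle (fst (snd w))) (fst (X (roll w))) (fst (snd (X (roll w)))) = 0
      \<and> no_slip_form l2 (abs_angle (snd (snd w))) (fst (X (roll w))) (snd (snd (X (roll w)))) = 0"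
    if "X \<in> sections (linkage_distribution l1 l2) U" "roll w \<in> U" for X w
    using that by (auto simp: sections_def linkage_distribution_def roll_def case_prod_unfold)
  have sm: "smooth_field_on U V" "smooth_field_on U W"
    using V W by (auto simp: sections_def)
  have *: "\<And>v. slip_defect l1 l2 (roll u) v =
      l1 * no_slip_form l1 (abs_angle (fst (snd u))) (fst v) (fst (snd v)) -
      l2 * no_slip_form l2 (abs_angle (snd (snd u))) (fst v) (snd (snd v))"
    by (simp add: slip_defect_def roll_def case_prod_unfold)
  show ?thesis
    unfolding p *
    using no_slip_form_bracket[OF assms(1) _ sm bounded_linear_fst, of u l1]
      no_slip_form_bracket[OF assms(1) _ sm bounded_linear_snd, of u l2]
      slip[OF V] slip[OF W] assms(2) by (simp add: p)
qed

lemma lie_flag_2_subset: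
  "lie_flag M (linkage_distribution l1 l2) 2 p \<subseteq> {v. slip_defect l1 l2 p v = 0}"
proof
  let ?D = "linkage_distribution l1 l2"
  interpret linear "slip_defect l1 l2 p" by (rule linear_slip_defect)
  fix v assume "v \<in> lie_flag M ?D 2 p"
  then obtain V U where U: "open U" "p \<in> U" and "v = V p" "V \<in> flag_sections ?D U (Suc (Suc 0))"
    unfolding lie_flag_def numeral_2_eq_2 by blast
  then obtain Y n X Z where v: "v = Y p + (\<Sum>i<n. lie_bracket (X i) (Z i) p)"
    and Y: "Y \<in> sections ?D U" and XZ: "\<forall>i<n::nat. X i \<in> sections ?D U \<and> Z i \<in> sections ?D U"
    by auto
  have "slip_defect l1 l2 p (Y p) = 0"
    using Y U by (auto simp: sections_def intro: slip_defect_distribution)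
  then show "v \<in> {v. slip_defect l1 l2 p v = 0}"
    using XZ slip_defect_bracket[OF U] by (simp add: v add sum)
qed

section \<open>Horizontal lifts of constant plane fields\<close>

text \<open>
  The section of $\mathcal D$ with constant planar component $q$; the two angular components solve
  the no-slip equations.
\<close>

definition horizontal_lift :: "real \<Rightarrow> real \<Rightarrow> real^2 \<Rightarrow> config \<Rightarrow> tangent"
  where "horizontal_lift l1 l2 q = (\<lambda>(x, \<alpha>1, \<alpha>2).
    (q, (angle_cos \<alpha>1 * q $ 2 - angle_sin \<alpha>1 * q $ 1) / l1,
        (angle_cos \<alpha>2 * q $ 2 - angle_sin \<alpha>2 * q $ 1) / l2))"

text \<open>
  In this form, with constant vectors as coefficients, the field is visibly a trigonometric
  polynomial, so that smoothness and derivatives need no reasoning about division.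
\<close>

lemma horizontal_lift_roll:
  "horizontal_lift l1 l2 q \<circ> roll = (\<lambda>u. (q, 0, 0)
    + cos (fst (snd u)) *\<^sub>R (0, q $ 2 / l1, 0) + sin (fst (snd u)) *\<^sub>R (0, - q $ 1 / l1, 0)
    + cos (snd (snd u)) *\<^sub>R (0, 0, q $ 2 / l2) + sin (snd (snd u)) *\<^sub>R (0, 0, - q $ 1 / l2))"
proof -
  have "(c * q $ 2 - s * q $ 1) / l = c * (q $ 2 / l) + s * (- q $ 1 / l)" for c s l :: real
    by (simp add: diff_divide_distrib)
  then show ?thesis
    by (simp add: horizontal_lift_def roll_def fun_eq_iff angle_cos.abs_eq angle_sin.abs_eq
        del: times_divide_eq_right)
qed

lemma frechet_derivative_horizontal_lift:
  "frechet_derivative (horizontal_lift l1 l2 q \<circ> roll) (at (x, a1, a2)) (h, h1, h2) =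
    (0, - h1 * (cos a1 * q $ 1 + sin a1 * q $ 2) / l1, - h2 * (cos a2 * q $ 1 + sin a2 * q $ 2) / l2)"
proof -
  have D: "((\<lambda>u. c + cos (fst (snd u)) *\<^sub>R a + sin (fst (snd u)) *\<^sub>R b
      + cos (snd (snd u)) *\<^sub>R d + sin (snd (snd u)) *\<^sub>R e) has_derivative (\<lambda>v.
      (- sin a1 * fst (snd v)) *\<^sub>R a + (cos a1 * fst (snd v)) *\<^sub>R b
      + (- sin a2 * snd (snd v)) *\<^sub>R d + (cos a2 * snd (snd v)) *\<^sub>R e)) (at (x, a1, a2))"
    for a b c d e :: tangent
    by (auto intro!: derivative_eq_intros simp: fun_eq_iff algebra_simps)
  show ?thesis
    unfolding horizontal_lift_roll frechet_derivative_at[OF D, symmetric]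
    by (simp add: add_divide_distrib diff_divide_distrib algebra_simps)
qed

lemma horizontal_lift_in_sections:
  assumes "l1 > 0" "l2 > 0"
  shows "horizontal_lift l1 l2 q \<in> sections (linkage_distribution l1 l2) U"
proof -
  have "smooth_field_on U (horizontal_lift l1 l2 q)"
    unfolding smooth_field_on_def horizontal_lift_roll by (rule smooth_trigonometric)
  moreover have "l1 \<noteq> 0" "l2 \<noteq> 0" using assms by auto
  ultimately show ?thesis
    by (auto simp: sections_def horizontal_lift_def linkage_distribution_def no_slip_form_def)
qed

text \<open>
  The squares of $\sin$ and $\cos$ combine, so these brackets are rotation fields that are constant
  over the whole configuration space. This makes the second round of brackets easy.
\<close>

lemma bracket_horizontal_lifts:
  "lie_bracket (horizontal_lift l1 l2 q) (horizontal_lift l1 l2 r) =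
    (\<lambda>p. (0, cross2 q r / l1\<^sup>2, cross2 q r / l2\<^sup>2))"
proof
  fix p :: config
  obtain x a1 a2 where p: "p = roll (x, a1, a2)"
    by (metis roll_unroll surj_pair)
  have lift: "horizontal_lift l1 l2 q (roll (x, a1, a2)) =
      (q, (cos a1 * q $ 2 - sin a1 * q $ 1) / l1, (cos a2 * q $ 2 - sin a2 * q $ 1) / l2)" for q
    by (simp add: horizontal_lift_def roll_def angle_cos.abs_eq angle_sin.abs_eq)
  have *: "(cos a * r $ 1 + sin a * r $ 2) * (cos a * q $ 2 - sin a * q $ 1) -
      (cos a * q $ 1 + sin a * q $ 2) * (cos a * r $ 2 - sin a * r $ 1) = - cross2 q r" for a
    using sin_cos_squared_add[of a] unfolding cross2_def by algebra
  have **: "- (A / l) * B / l + (C / l) * D / l = k / l\<^sup>2" if "B * A - D * C = - k"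
    for A B C D k l :: real
  proof -
    have k: "k = D * C - B * A" using that by simp
    show ?thesis by (simp add: k power2_eq_square diff_divide_distrib mult.commute)
  qed
  show "lie_bracket (horizontal_lift l1 l2 q) (horizontal_lift l1 l2 r) p =
      (0, cross2 q r / l1\<^sup>2, cross2 q r / l2\<^sup>2)"
    using **[OF *[of a1], of l1] **[OF *[of a2], of l2]
    by (simp add: p lie_bracket_roll lift frechet_derivative_horizontal_lift)
qed

lemma bracket_horizontal_lift_const:
  "lie_bracket (horizontal_lift l1 l2 q) (\<lambda>p. (0, b1, b2)) (x, \<alpha>1, \<alpha>2) =
    (0, b1 * (angle_cos \<alpha>1 * q $ 1 + angle_sin \<alpha>1 * q $ 2) / l1,
        b2 * (angle_cos \<alpha>2 * q $ 1 + angle_sin \<alpha>2 * q $ 2) / l2)"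
proof -
  obtain a1 a2 where a: "\<alpha>1 = abs_angle a1" "\<alpha>2 = abs_angle a2"
    by (metis Quotient3_abs_rep[OF Quotient3_angle])
  have p: "(x, \<alpha>1, \<alpha>2) = roll (x, a1, a2)" by (simp add: roll_def a)
  have "((\<lambda>p::config. (0, b1, b2) :: tangent) \<circ> roll) = (\<lambda>u. (0, b1, b2))" by auto
  then show ?thesis
    unfolding p lie_bracket_roll frechet_derivative_horizontal_lift
    by (simp add: a angle_cos.abs_eq angle_sin.abs_eq frechet_derivative_const)
qed

section \<open>The growth of the flag\<close>

lemma linkage_distribution_eq_range_lift:
  assumes "l1 > 0" "l2 > 0"
  shows "linkage_distribution l1 l2 p = range (\<lambda>q. horizontal_lift l1 l2 q p)"
  using assms
  by (cases p) (auto simp: linkage_distribution_def horizontal_lift_def no_slip_form_def field_simps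
      intro!: image_eqI)

text \<open>
  The common value $k$ of $l_i \lambda_i$ and the planar component $q$ are coordinates on the kernel;
  subtracting the angular vector with $\lambda_i = k / l_i$ leaves a horizontal vector.
\<close>

lemma kernel_slip_defect:
  assumes "l1 > 0" "l2 > 0"
  shows "{v. slip_defect l1 l2 p v = 0} =
    range (\<lambda>(q, k). horizontal_lift l1 l2 q p + (0, k / l1\<^sup>2, k / l2\<^sup>2))"
proof (intro subset_antisym subsetI)
  fix v assume "v \<in> {v. slip_defect l1 l2 p v = 0}"
  then show "v \<in> range (\<lambda>(q, k). horizontal_lift l1 l2 q p + (0, k / l1\<^sup>2, k / l2\<^sup>2))"
    using assms
    by (cases p; cases v)
      (auto simp: slip_defect_def horizontal_lift_def no_slip_form_def field_simps power2_eq_square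
        intro!: image_eqI[where x = "(fst v, l1 * no_slip_form l1 (fst (snd p)) (fst v) (fst (snd v)))"])
qed (use assms in \<open>cases p, auto simp: slip_defect_def horizontal_lift_def no_slip_form_def
  field_simps power2_eq_square\<close>)

lemma flag_sections_add_bracket:
  assumes "X \<in> sections D U" "Y \<in> flag_sections D U (Suc k)" "Z \<in> flag_sections D U (Suc k)"
  shows "(\<lambda>p. Y p + lie_bracket X Z p) \<in> flag_sections D U (Suc (Suc k))"
proof -
  have "(\<lambda>p. Y p + lie_bracket X Z p) = (\<lambda>p. Y p + (\<Sum>i<Suc 0. lie_bracket X Z p))"
    by simp
  then show ?thesis
    unfolding flag_sections.simps mem_Collect_eq
    using assms by (intro exI[of _ Y] exI[of _ "Suc 0"] exI[of _ "\<lambda>_. X"] exI[of _ "\<lambda>_. Z"]) auto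
qed

text \<open>
  The plane vectors $(k, 0)$ and $(0, 1)$ have cross product $k$, so a single bracket of lifts
  produces the rotation part.
\<close>

lemma flag_sections_2_fields:
  assumes "l1 > 0" "l2 > 0"
  shows "(\<lambda>p. horizontal_lift l1 l2 q p + (0, k / l1\<^sup>2, k / l2\<^sup>2)) \<in>
    flag_sections (linkage_distribution l1 l2) U 2"
proof -
  have "cross2 (axis 1 k) (axis 2 1) = k"
    by (simp add: cross2_def axis_def)
  then show ?thesis
    using flag_sections_add_bracket[of "horizontal_lift l1 l2 (axis 1 k)" "linkage_distribution l1 l2"
        U "horizontal_lift l1 l2 q" 0 "horizontal_lift l1 l2 (axis 2 1)"]
    by (simp add: horizontal_lift_in_sections[OF assms] bracket_horizontal_lifts
        flip: numeral_2_eq_2 del: flag_sections.simps(3))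
qed

lemma lie_flag_2_linkage:
  assumes "l1 > 0" "l2 > 0" "p \<in> linkage_space l1 l2"
  shows "lie_flag (linkage_space l1 l2) (linkage_distribution l1 l2) 2 p =
    {v. slip_defect l1 l2 p v = 0}"
proof (rule subset_antisym[OF lie_flag_2_subset])
  show "{v. slip_defect l1 l2 p v = 0} \<subseteq>
      lie_flag (linkage_space l1 l2) (linkage_distribution l1 l2) 2 p"
    unfolding kernel_slip_defect[OF assms(1,2)] lie_flag_def
    using flag_sections_2_fields[OF assms(1,2)] open_linkage_space assms(3) by fastforce
qed

lemma slip_defect_second_bracket:
  assumes "l1 > 0" "l2 > 0"
  shows "slip_defect l1 l2 (x, \<alpha>1, \<alpha>2)
      (lie_bracket (horizontal_lift l1 l2 q) (\<lambda>p. (0, 1 / l1\<^sup>2, 1 / l2\<^sup>2)) (x, \<alpha>1, \<alpha>2)) =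
    (angle_cos \<alpha>1 / l1 - angle_cos \<alpha>2 / l2) * q $ 1 + (angle_sin \<alpha>1 / l1 - angle_sin \<alpha>2 / l2) * q $ 2"
  using assms unfolding bracket_horizontal_lift_const
  by (simp add: slip_defect_def no_slip_form_def field_simps power2_eq_square)

text \<open>
  If both coefficients vanish, then $l_2 e_1 = l_1 e_2$ for the unit vectors $e_i$ along the
  segments; comparing lengths gives $l_1 = l_2$, hence $e_1 = e_2$ and the wheels coincide.
\<close>

lemma bracket_coefficient_nonzero:
  assumes "l1 > 0" "l2 > 0" "(x, \<alpha>1, \<alpha>2) \<in> linkage_space l1 l2"
  shows "angle_cos \<alpha>1 / l1 - angle_cos \<alpha>2 / l2 \<noteq> 0 \<or> angle_sin \<alpha>1 / l1 - angle_sin \<alpha>2 / l2 \<noteq> 0"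
proof (rule ccontr)
  assume "\<not> ?thesis"
  then have *: "angle_cos \<alpha>1 * l2 = angle_cos \<alpha>2 * l1" "angle_sin \<alpha>1 * l2 = angle_sin \<alpha>2 * l1"
    using assms by (simp_all add: field_simps)
  then have "(l1::real)\<^sup>2 = l2\<^sup>2"
    using angle_sin_cos_squared[of \<alpha>1] angle_sin_cos_squared[of \<alpha>2] by algebra
  then have "l1 = l2" using assms by simp
  then show False
    using * assms by (simp add: linkage_space_def wheel_def)
qed

lemma lie_flag_3_linkage:
  assumes "l1 > 0" "l2 > 0" "p \<in> linkage_space l1 l2"
  shows "lie_flag (linkage_space l1 l2) (linkage_distribution l1 l2) 3 p = UNIV"
proof -
  let ?M = "linkage_space l1 l2" and ?D = "linkage_distribution l1 l2"
  let ?Z = "\<lambda>p::config. (0, 1 / l1\<^sup>2, 1 / l2\<^sup>2) :: tangent"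
  obtain x \<alpha>1 \<alpha>2 where p: "p = (x, \<alpha>1, \<alpha>2)" by (cases p)
  interpret linear "slip_defect l1 l2 p" by (rule linear_slip_defect)
  define A B where "A = angle_cos \<alpha>1 / l1 - angle_cos \<alpha>2 / l2"
    and "B = angle_sin \<alpha>1 / l1 - angle_sin \<alpha>2 / l2"
  define N where "N = A\<^sup>2 + B\<^sup>2"
  have N: "N \<noteq> 0"
    using bracket_coefficient_nonzero[OF assms(1,2), of x \<alpha>1 \<alpha>2] assms(3)
    by (auto simp: N_def A_def B_def p sum_power2_eq_zero_iff)
  \<comment> \<open>\<open>?Z\<close> is the case \<open>q = 0\<close>, \<open>k = 1\<close>.\<close>
  have Z: "?Z \<in> flag_sections ?D ?M 2"
    using flag_sections_2_fields[OF assms(1,2), of 0 1 ?M]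
    by (simp add: horizontal_lift_def case_prod_unfold)
  have "v \<in> lie_flag ?M ?D 3 p" for v
  proof -
    \<comment> \<open>The plane vector proportional to \<open>(A, B)\<close> that corrects the slip defect of \<open>v\<close>.\<close>
    define t where "t = slip_defect l1 l2 p v / N"
    define X where "X = horizontal_lift l1 l2 (vector [t * A, t * B])"
    have "slip_defect l1 l2 p (lie_bracket X ?Z p) = t * N"
      unfolding X_def p slip_defect_second_bracket[OF assms(1,2)] A_def[symmetric] B_def[symmetric]
      by (simp add: N_def power2_eq_square algebra_simps)
    then have "slip_defect l1 l2 p (v - lie_bracket X ?Z p) = 0"
      using N by (simp add: diff t_def)
    then have "v - lie_bracket X ?Z p \<in>
        range (\<lambda>(q, k). horizontal_lift l1 l2 q p + (0, k / l1\<^sup>2, k / l2\<^sup>2))"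
      unfolding kernel_slip_defect[OF assms(1,2), symmetric] by simp
    then obtain q k where qk: "v - lie_bracket X ?Z p =
        horizontal_lift l1 l2 q p + (0, k / l1\<^sup>2, k / l2\<^sup>2)"
      by fast
    define Y where "Y = (\<lambda>p. horizontal_lift l1 l2 q p + (0, k / l1\<^sup>2, k / l2\<^sup>2))"
    have "X \<in> sections ?D ?M" "Y \<in> flag_sections ?D ?M 2"
      using horizontal_lift_in_sections flag_sections_2_fields assms by (auto simp: X_def Y_def)
    then have "(\<lambda>p. Y p + lie_bracket X ?Z p) \<in> flag_sections ?D ?M 3"
      using Z flag_sections_add_bracket[of X ?D ?M Y "Suc 0" ?Z]
      by (simp flip: numeral_2_eq_2 numeral_3_eq_3 del: flag_sections.simps)
    moreover have "v = Y p + lie_bracket X ?Z p"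
      using qk by (simp add: Y_def algebra_simps)
    ultimately show ?thesis
      using open_linkage_space assms(3) unfolding lie_flag_def
      by (intro CollectI exI[of _ "\<lambda>p. Y p + lie_bracket X ?Z p"] exI[of _ ?M]) auto
  qed
  then show ?thesis by blast
qed

lemma dim_range_injective:
  fixes f :: "'a::euclidean_space \<Rightarrow> 'b::euclidean_space"
  assumes "linear f" "inj f"
  shows "dim (range f) = DIM('a)"
  using assms dim_image_eq[of f UNIV] by simp

lemma dim_linkage_distribution:
  assumes "l1 > 0" "l2 > 0"
  shows "dim (linkage_distribution l1 l2 p) = 2"
proof -
  have "linear (\<lambda>q. horizontal_lift l1 l2 q p)"
    by (rule linearI) (auto simp: horizontal_lift_def case_prod_unfold algebra_simps
        add_divide_distrib diff_divide_distrib)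
  moreover have "inj (\<lambda>q. horizontal_lift l1 l2 q p)"
    by (auto intro!: injI simp: horizontal_lift_def case_prod_unfold)
  ultimately show ?thesis
    using dim_range_injective linkage_distribution_eq_range_lift[OF assms, of p] by fastforce
qed

lemma dim_kernel_slip_defect:
  assumes "l1 > 0" "l2 > 0"
  shows "dim {v. slip_defect l1 l2 p v = 0} = 3"
proof -
  let ?f = "\<lambda>(q, k). horizontal_lift l1 l2 q p + (0, k / l1\<^sup>2, k / l2\<^sup>2)"
  have "linear ?f"
    by (rule linearI) (auto simp: horizontal_lift_def case_prod_unfold algebra_simps
        add_divide_distrib diff_divide_distrib)
  moreover have "inj ?f"
    using assms by (auto intro!: injI simp: horizontal_lift_def case_prod_unfold)
  ultimately show ?thesis
    unfolding kernel_slip_defect[OF assms] by (simp add: dim_range_injective)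
qed

theorem theorem2:
  fixes l1 l2 :: real
  assumes "l1 > 0" and "l2 > 0"
  shows "completely_nonintegrable_on (linkage_space l1 l2) (linkage_distribution l1 l2) \<and>
    (\<forall>p \<in> linkage_space l1 l2.
      dim (lie_flag (linkage_space l1 l2) (linkage_distribution l1 l2) 1 p) = 2 \<and>
      dim (lie_flag (linkage_space l1 l2) (linkage_distribution l1 l2) 2 p) = 3 \<and>
      dim (lie_flag (linkage_space l1 l2) (linkage_distribution l1 l2) 3 p) = 4)"
  unfolding completely_nonintegrable_on_def
  using lie_flag_1_linkage[OF assms] lie_flag_2_linkage[OF assms] lie_flag_3_linkage[OF assms]
    dim_linkage_distribution[OF assms] dim_kernel_slip_defect[OF assms]
  by (auto intro!: exI[of _ 3])

end
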